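(* Suppose that there exist measurable functions $L_n:\Theta_n\to(0,\infty)$, $n\in\mathbb{N}$, a point $x_0\in X$ and $n_0\in\mathbb{N}$ such that the following conditions hold: (A1) For each $n\in\mathbb{N}$ and $\vartheta_n$-a.e. $\theta\in\Theta_n$, $\rho\big(S_\theta^{(n)}(x),S_\theta^{(n)}(y)\big)\le L_n(\theta)\rho(x,y)$ for any $x,y\in X$. (A2) For every $E\in\mathcal{B}((0,\infty))$, $\vartheta_n(L_n^{-1}(E))$ does not depend on $n$, and $R:=\int_{\Theta_1}L_1(\theta)\,\vartheta_1(d\theta)<\infty$, $\int_{\Theta_1}\ln L_1(\theta)\,\vartheta_1(d\theta)<0$. (A3') $\displaystyle\Delta:=\sup_{n\ge n_0}\int_{\Theta_n}\rho\big(x_0,S_\theta^{(n)}(x_0)\big)\,\vartheta_n(d\theta)<\infty.$ Then there exist a measure $\bar\pi\in\mathcal{M}_1(X)$ and constants $\bar q\in(0,1)$, $\bar C\in[0,\infty)$ such that $$d_{BL}\big(\mu\bar P^{(n)},\bar\pi\big)\le\bar C\bar q^{\,n}\big(1+\langle V,\mu\rangle\big)\quad\text{for any }\mu\in\mathcal{M}_{1,1}(X),\ n\in\mathbb{N},$$ where $V(x):=\rho(x,x_0)$ for $x\in X$, and, in particular, $\mu\bar P^{(n)}$ converges weakly to $\bar\pi$ as $n\to\infty$ for every $\mu\in\mathcal{M}_1(X)$.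
   Context: Setting. $(X,\rho)$ is a Polish (complete separable) metric space with Borel $\sigma$-field $\mathcal{B}(X)$; $\{(\Theta_n,\mathcal{A}_n,\vartheta_n)\}_{n\in\mathbb{N}}$ is an arbitrary sequence of probability spaces; for each $n\in\mathbb{N}$, $\{S_\theta^{(n)}:\theta\in\Theta_n\}$ is a family of maps from $X$ into itself such that $X\times\Theta_n\ni(x,\theta)\mapsto S_\theta^{(n)}(x)\in X$ is $\mathcal{B}(X)\otimes\mathcal{A}_n/\mathcal{B}(X)$-measurable. Measures. $\mathcal{M}_1(X)$ is the set of Borel probability measures on $X$; $\mathcal{M}_{1,1}(X)$ is the set of $\mu\in\mathcal{M}_1(X)$ with $\int_X\rho(x,z)\,\mu(dx)<\infty$ for some (equivalently all) $z\in X$; $\langle f,\mu\rangle:=\int_X f\,d\mu$. $L_{b,1}(X)$ is the set of functions $f:X\to[-1,1]$ that are Lipschitz with constant at most $1$, and $d_{BL}(\mu,\nu):=\sup_{f\in L_{b,1}(X)}|\langle f,\mu\rangle-\langle f,\nu\rangle|$. Weak convergence $\mu_n\to\mu$ means $\langle f,\mu_n\rangle\to\langle f,\mu\rangle$ for all bounded continuous $f:X\to\mathbb{R}$. Kernels. $P_n(x,A):=\int_{\Theta_n}\mathbf{1}_A(S_\theta^{(n)}(x))\,\vartheta_n(d\theta)$; $\mu P_n(A):=\int_X P_n(x,A)\,\mu(dx)$; $\mu\bar P^{(n)}:=\mu P_nP_{n-1}\cdots P_1$ (apply $P_n$ first and $P_1$ last). Thus $\mu\bar P^{(n)}$ is the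 law of $\Psi_n^\mu=(S_{\eta_1}^{(1)}\circ\cdots\circ S_{\eta_n}^{(n)})(\Psi_0^\mu)$, where $\Psi_0^\mu\sim\mu$, and $\eta_1,\eta_2,\ldots$ are mutually independent, independent of $\Psi_0^\mu$, with $\eta_k\sim\vartheta_k$. *)

theory Defs
  imports "HOL-Probability.Probability"
begin

definition M1 :: "'a::metric_space measure set" where
  "M1 = {\<mu>. prob_space \<mu> \<and> sets \<mu> = sets borel}"

definition M11 :: "'a::metric_space measure set" where
  "M11 = {\<mu> \<in> M1. \<exists>z. (\<integral>\<^sup>+x. ennreal (dist x z) \<partial>\<mu>) < \<infinity>}"

definition L_b1 :: "('a::metric_space \<Rightarrow> real) set" where
  "L_b1 = {f. range f \<subseteq> {-1..1} \<and> 1-lipschitz_on UNIV f}"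

text \<open>For elements of \<open>M1\<close> the set under the real-valued supremum is nonempty and bounded by 2.\<close>

definition d_BL :: "'a::metric_space measure \<Rightarrow> 'a measure \<Rightarrow> real" where
  "d_BL \<mu> \<nu> = (SUP f\<in>L_b1. \<bar>(\<integral>x. f x \<partial>\<mu>) - (\<integral>x. f x \<partial>\<nu>)\<bar>)"

definition converges_weakly :: "(nat \<Rightarrow> 'a::metric_space measure) \<Rightarrow> 'a measure \<Rightarrow> bool" where
  "converges_weakly \<mu>s \<mu> \<longleftrightarrow>
     (\<forall>f::'a \<Rightarrow> real. continuous_on UNIV f \<and> bounded (range f) \<longrightarrow>
        (\<lambda>n. \<integral>x. f x \<partial>\<mu>s n) \<longlonglongrightarrow> (\<integral>x. f x \<partial>\<mu>))"

text \<open>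
  The integral of a function with integrable positive or negative part, with values in
  \<open>[-\<infinity>, \<infinity>]\<close>. The Bochner integral is 0 for every non-integrable function, so it cannot
  express an integral equal to \<open>-\<infinity>\<close>. If both parts have infinite integral, the value
  here is \<open>\<infinity>\<close>.
\<close>

definition ext_integral :: "'b measure \<Rightarrow> ('b \<Rightarrow> real) \<Rightarrow> ereal" where
  "ext_integral M f =
     enn2ereal (\<integral>\<^sup>+x. ennreal (f x) \<partial>M) - enn2ereal (\<integral>\<^sup>+x. ennreal (- f x) \<partial>M)"

lemma ext_integral_eq_integral:
  assumes "integrable M f"
  shows "ext_integral M f = ereal (\<integral>x. f x \<partial>M)"
proof -
  have *: "(\<integral>\<^sup>+x. ennreal (f x) \<partial>M) < \<infinity>" "(\<integral>\<^sup>+x. ennreal (- f x) \<partial>M) < \<infinity>"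
    using assms by (auto simp: real_integrable_def less_top)
  obtain a b where "0 \<le> a" "(\<integral>\<^sup>+x. ennreal (f x) \<partial>M) = ennreal a"
    and "0 \<le> b" "(\<integral>\<^sup>+x. ennreal (- f x) \<partial>M) = ennreal b"
    using * by (metis ennreal_cases infinity_ennreal_def less_irrefl)
  then show ?thesis
    by (simp add: ext_integral_def real_lebesgue_integral_def[OF assms] enn2ereal_ennreal)
qed

text \<open>
  \<open>step_kernel T s x\<close> is the law of \<open>s \<theta> x\<close> for \<open>\<theta>\<close> distributed according to \<open>T\<close>.
\<close>

definition step_kernel ::
  "'b measure \<Rightarrow> ('b \<Rightarrow> 'a \<Rightarrow> 'a::metric_space) \<Rightarrow> 'a \<Rightarrow> 'a measure" where
  "step_kernel T s x = distr T borel (\<lambda>\<theta>. s \<theta> x)"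

definition apply_step ::
  "'b measure \<Rightarrow> ('b \<Rightarrow> 'a \<Rightarrow> 'a::metric_space) \<Rightarrow> 'a measure \<Rightarrow> 'a measure" where
  "apply_step T s \<mu> = \<mu> \<bind> step_kernel T s"

text \<open>
  \<open>P_bar T S n \<mu> = \<mu> P\<^sub>n P\<^sub>n\<^sub>-\<^sub>1 \<dots> P\<^sub>1\<close>; the kernel with index \<open>n\<close> acts first. Indices start at 1,
  and the families' values at index 0 are never used.
\<close>

primrec P_bar ::
  "(nat \<Rightarrow> 'b measure) \<Rightarrow> (nat \<Rightarrow> 'b \<Rightarrow> 'a \<Rightarrow> 'a::metric_space) \<Rightarrow> nat \<Rightarrow> 'a measure \<Rightarrow> 'a measure"
where
  "P_bar T S 0 \<mu> = \<mu>"
| "P_bar T S (Suc n) \<mu> = P_bar T S n (apply_step (T (Suc n)) (S (Suc n)) \<mu>)"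

lemma emeasure_step_kernel:
  fixes s :: "'b \<Rightarrow> 'a::metric_space \<Rightarrow> 'a"
  assumes s: "(\<lambda>(x, \<theta>). s \<theta> x) \<in> borel \<Otimes>\<^sub>M T \<rightarrow>\<^sub>M borel" and A: "A \<in> sets borel"
  shows "emeasure (step_kernel T s x) A = (\<integral>\<^sup>+\<theta>. indicator A (s \<theta> x) \<partial>T)"
proof -
  have [measurable]: "(\<lambda>\<theta>. s \<theta> x) \<in> T \<rightarrow>\<^sub>M borel"
    using measurable_compose[OF measurable_Pair1'[of x borel T] s] by simp
  have "(\<integral>\<^sup>+\<theta>. indicator A (s \<theta> x) \<partial>T) = (\<integral>\<^sup>+y. indicator A y \<partial>step_kernel T s x)"
    unfolding step_kernel_def using A by (subst nn_integral_distr) auto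
  also have "\<dots> = emeasure (step_kernel T s x) A"
    using A by (simp add: step_kernel_def)
  finally show ?thesis ..
qed

lemma step_kernel_measurable:
  fixes s :: "'b \<Rightarrow> 'a::metric_space \<Rightarrow> 'a"
  assumes "prob_space T" and s: "(\<lambda>(x, \<theta>). s \<theta> x) \<in> borel \<Otimes>\<^sub>M T \<rightarrow>\<^sub>M borel"
  shows "step_kernel T s \<in> borel \<rightarrow>\<^sub>M subprob_algebra borel"
proof -
  interpret prob_space T by fact
  have "T \<in> space (subprob_algebra T)"
    by (simp add: space_subprob_algebra prob_space_imp_subprob_space prob_space_axioms)
  then have "(\<lambda>x. distr T borel (\<lambda>\<theta>. s \<theta> x)) \<in> borel \<rightarrow>\<^sub>M subprob_algebra borel"
    by (intro measurable_distr2[where M = T] s) simp_all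
  then show ?thesis
    by (simp add: step_kernel_def[abs_def])
qed

lemma emeasure_apply_step:
  fixes s :: "'b \<Rightarrow> 'a::metric_space \<Rightarrow> 'a"
  assumes "prob_space T" "(\<lambda>(x, \<theta>). s \<theta> x) \<in> borel \<Otimes>\<^sub>M T \<rightarrow>\<^sub>M borel"
    and \<mu>: "sets \<mu> = sets borel" and A: "A \<in> sets borel"
  shows "emeasure (apply_step T s \<mu>) A = (\<integral>\<^sup>+x. emeasure (step_kernel T s x) A \<partial>\<mu>)"
  unfolding apply_step_def
proof (rule emeasure_bind)
  show "space \<mu> \<noteq> {}" using sets_eq_imp_space_eq[OF \<mu>] by simp
  show "step_kernel T s \<in> \<mu> \<rightarrow>\<^sub>M subprob_algebra borel"
    using step_kernel_measurable[OF assms(1,2)] \<mu> by (simp cong: measurable_cong_sets)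
qed fact

end

theory Submission
  imports Defs
begin

text \<open>
  Since \<open>\<integral> ln L < 0\<close>, some moment \<open>q = \<integral> L powr a\<close> with \<open>0 < a \<le> 1\<close> is below 1, so on average every
  map contracts the metric \<open>dist powr a\<close> by the factor \<open>q\<close>. Drive the maps by the infinite product of
  the measures \<open>T n\<close>. The backward iterates of \<open>x0\<close> move in step \<open>n\<close> by \<open>O(q ^ n)\<close> in mean, hence
  converge almost surely; \<open>\<pi>\<close> is the law of the limit. Those of any other point have the same limit,
  which gives weak convergence by dominated convergence. Functions in \<open>L_b1\<close> are Lipschitz with
  constant 2 for \<open>dist powr a\<close>, which turns the two mean estimates into the geometric rate.
\<close>

section \<open>A fractional moment below one\<close>

text \<open>This is the derivative of \<open>a \<mapsto> x powr a\<close> at 0. It is taken along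
  the exponents \<open>1 / real (Suc n)\<close> because Fatou's lemma is applied to a
  sequence.\<close>

lemma difference_quotient_powr_tendsto_ln:
  fixes x :: real
  assumes "x > 0"
  shows "(\<lambda>n. (x powr (1 / real (Suc n)) - 1) / (1 / real (Suc n))) \<longlonglongrightarrow> ln x"
proof -
  have "((\<lambda>a. x powr a) has_real_derivative ln x) (at 0)"
    using assms by (auto intro!: derivative_eq_intros)
  then have *: "((\<lambda>h. (x powr h - 1) / h) \<longlongrightarrow> ln x) (at 0)"
    using assms by (simp add: DERIV_def)
  have "filterlim (\<lambda>n. 1 / real (Suc n)) (at 0) sequentially"
    unfolding filterlim_at using lim_1_over_n[THEN LIMSEQ_Suc] by auto
  from filterlim_compose[OF * this] show ?thesis .
qed

text \<open>Weighted arithmetic-geometric mean inequality for \<open>x\<close> and 1 with weights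
  \<open>a\<close> and \<open>1 - a\<close>. It makes the functions in the Fatou argument
  nonnegative.\<close>

lemma powr_le_tangent:
  fixes x a :: real
  assumes "x > 0" "0 \<le> a" "a \<le> 1"
  shows "x powr a \<le> 1 + a * (x - 1)"
  using Youngs_inequality_0[of a "1 - a" x 1] assms by (simp add: algebra_simps)

lemma powr_le_one_plus:
  fixes x a :: real
  assumes "x \<ge> 0" "0 < a" "a \<le> 1"
  shows "x powr a \<le> 1 + x"
proof (cases "x \<le> 1")
  case True
  then show ?thesis using powr_mono2[of a x 1] assms by simp
next
  case False
  then show ?thesis using powr_mono[of a 1 x] assms by simp
qed

text \<open>
  The map \<open>a \<mapsto> \<integral> X powr a\<close> equals 1 at 0 and has derivative \<open>\<integral> ln X < 0\<close> there. As
  \<open>\<integral> ln X = -\<infinity>\<close> is allowed, the derivative is compared through Fatou's lemma, applied to the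
  nonnegative functions \<open>(X - 1) - (X powr a - 1) / a\<close>.
\<close>

lemma exists_contracting_moment:
  fixes X :: "'b \<Rightarrow> real"
  assumes "prob_space M" and X[measurable]: "X \<in> borel_measurable M"
    and pos: "\<And>w. w \<in> space M \<Longrightarrow> X w > 0"
    and fin: "(\<integral>\<^sup>+w. ennreal (X w) \<partial>M) < \<infinity>"
    and neg: "ext_integral M (\<lambda>w. ln (X w)) < 0"
  obtains a where "0 < a" "a \<le> 1" "(\<integral>\<^sup>+w. ennreal (X w powr a) \<partial>M) < 1"
proof (rule ccontr)
  interpret prob_space M by fact
  define a where "a n = 1 / real (Suc n)" for n
  have a: "0 < a n" "a n \<le> 1" for n by (simp_all add: a_def)
  assume "\<not> thesis"
  then have ge: "(\<integral>\<^sup>+w. ennreal (X w powr a n) \<partial>M) \<ge> 1" for n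
    using that a by (meson not_le)
  have intX: "integrable M X"
    using fin pos by (intro integrableI_nonneg) (auto intro!: AE_I2 less_imp_le)
  have intXa: "integrable M (\<lambda>w. X w powr a n)" for n
  proof (rule Bochner_Integration.integrable_bound)
    show "integrable M (\<lambda>w. 1 + X w)" using intX by simp
    show "AE w in M. norm (X w powr a n) \<le> norm (1 + X w)"
    proof (rule AE_I2)
      fix w assume "w \<in> space M"
      from pos[OF this] show "norm (X w powr a n) \<le> norm (1 + X w)"
        using powr_le_one_plus[of "X w" "a n"] a[of n] by simp
    qed
  qed simp
  define g where "g n w = (X w - 1) - (X w powr a n - 1) / a n" for n w
  define h where "h w = X w - 1 - ln (X w)" for w
  have [measurable]: "h \<in> borel_measurable M" "g n \<in> borel_measurable M" for n
    unfolding h_def g_def by measurable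
  have g_nonneg: "g n w \<ge> 0" if "w \<in> space M" for n w
    using powr_le_tangent[OF pos[OF that], of "a n"] a[of n] by (simp add: g_def field_simps)
  have h_nonneg: "h w \<ge> 0" if "w \<in> space M" for w
    using ln_le_minus_one[OF pos[OF that]] by (simp add: h_def)
  have int_g: "integrable M (g n)" for n
    unfolding g_def using intX intXa by simp
  have lim: "(\<lambda>n. g n w) \<longlonglongrightarrow> h w" if "w \<in> space M" for w
    unfolding g_def h_def a_def
    by (intro tendsto_intros difference_quotient_powr_tendsto_ln pos that)
  \<comment> \<open>If no exponent works, every moment is at least 1, so the subtracted difference
    quotient has nonnegative mean. The resulting bound is uniform in \<open>n\<close> and thus
    survives the passage to the limit.\<close>
  have g_le: "(\<integral>w. g n w \<partial>M) \<le> (\<integral>w. X w \<partial>M) - 1" for n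
  proof -
    have "ennreal 1 \<le> ennreal (\<integral>w. X w powr a n \<partial>M)"
      using ge[of n] by (subst (asm) nn_integral_eq_integral[OF intXa]) auto
    then have "1 \<le> (\<integral>w. X w powr a n \<partial>M)"
      by (subst (asm) ennreal_le_iff) auto
    moreover have "(\<integral>w. g n w \<partial>M)
        = (\<integral>w. X w \<partial>M) - 1 - ((\<integral>w. X w powr a n \<partial>M) - 1) / a n"
      unfolding g_def using intX intXa by (simp add: prob_space)
    ultimately show ?thesis using a[of n] by simp
  qed
  \<comment> \<open>\<open>ennreal\<close> sends negative reals to 0, so the Fatou bound can be read
    as a bound between reals only once its right-hand side is known to be nonnegative.\<close>
  have ge0: "0 \<le> (\<integral>w. X w \<partial>M) - 1"
  proof -
    have "0 \<le> (\<integral>w. g 0 w \<partial>M)" by (intro integral_nonneg_AE AE_I2 g_nonneg)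
    then show ?thesis using g_le[of 0] by linarith
  qed
  have "(\<integral>\<^sup>+w. ennreal (h w) \<partial>M) = (\<integral>\<^sup>+w. liminf (\<lambda>n. ennreal (g n w)) \<partial>M)"
    by (intro nn_integral_cong lim_imp_Liminf[symmetric] tendsto_ennrealI lim) auto
  also have "\<dots> \<le> liminf (\<lambda>n. \<integral>\<^sup>+w. ennreal (g n w) \<partial>M)"
    by (rule nn_integral_liminf) simp
  also have "\<dots> \<le> ennreal ((\<integral>w. X w \<partial>M) - 1)"
  proof (rule Liminf_le)
    show "\<forall>\<^sub>F n in sequentially. (\<integral>\<^sup>+w. ennreal (g n w) \<partial>M) \<le> ennreal ((\<integral>w. X w \<partial>M) - 1)"
      using g_le g_nonneg int_g
      by (intro always_eventually allI) (simp add: nn_integral_eq_integral ennreal_leI)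
  qed simp
  finally have nn_h: "(\<integral>\<^sup>+w. ennreal (h w) \<partial>M) \<le> ennreal ((\<integral>w. X w \<partial>M) - 1)" .
  \<comment> \<open>Integrability of \<open>h\<close> makes \<open>ln X\<close> integrable, which
    excludes the value \<open>-\<infinity>\<close>. The extended integral is then the ordinary one,
    and the bound on the mean of \<open>h\<close> makes it nonnegative, contradicting
    \<open>neg\<close>.\<close>
  have int_h: "integrable M h"
    using nn_h h_nonneg
    by (intro integrableI_nonneg) (auto intro!: AE_I2 order.strict_trans1[OF nn_h])
  have "(\<integral>w. h w \<partial>M) \<le> (\<integral>w. X w \<partial>M) - 1"
    using nn_h h_nonneg ge0 by (simp add: nn_integral_eq_integral[OF int_h])
  moreover have ln_eq: "(\<lambda>w. ln (X w)) = (\<lambda>w. X w - 1 - h w)"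
    by (simp add: h_def)
  have int_ln: "integrable M (\<lambda>w. ln (X w))"
    unfolding ln_eq using intX int_h by simp
  moreover have "(\<integral>w. ln (X w) \<partial>M) = (\<integral>w. X w \<partial>M) - 1 - (\<integral>w. h w \<partial>M)"
    unfolding ln_eq using intX int_h by (simp add: prob_space)
  ultimately show False
    using neg ext_integral_eq_integral[OF int_ln] by simp
qed

section \<open>Measurability and integration tools\<close>

text \<open>Coordinate \<open>i\<close> is independent of all the others. Since
  \<open>F \<theta>\<close> does not look at coordinate \<open>i\<close>, the random value
  \<open>w i\<close> can be frozen to \<open>\<theta>\<close> and integrated last: Fubini for the
  splitting of the product into factor \<open>i\<close> and the rest.\<close>

lemma nn_integral_PiM_coordinate:
  fixes M :: "'i \<Rightarrow> 'b measure" and F :: "'b \<Rightarrow> ('i \<Rightarrow> 'b) \<Rightarrow> ennreal"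
  assumes prob: "\<And>i. prob_space (M i)"
    and F[measurable]: "(\<lambda>(\<theta>, w). F \<theta> w) \<in> borel_measurable (M i \<Otimes>\<^sub>M PiM UNIV M)"
    and indep: "\<And>\<theta> \<theta>' w. F \<theta> (w(i := \<theta>')) = F \<theta> w"
  shows "(\<integral>\<^sup>+w. F (w i) w \<partial>PiM UNIV M) = (\<integral>\<^sup>+\<theta>. \<integral>\<^sup>+w. F \<theta> w \<partial>PiM UNIV M \<partial>M i)"
proof -
  define N where "N = PiM (UNIV - {i}) M"
  interpret N: prob_space N
    unfolding N_def by (intro prob_space_PiM prob)
  interpret Mi: prob_space "M i" by (rule prob)
  have upd[measurable]: "(\<lambda>(\<theta>, w). w(i := \<theta>)) \<in> M i \<Otimes>\<^sub>M N \<rightarrow>\<^sub>M PiM UNIV M"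
  proof -
    have "(\<lambda>p. (snd p)(i := fst p)) \<in> M i \<Otimes>\<^sub>M N \<rightarrow>\<^sub>M PiM UNIV M"
      unfolding N_def
      by (rule measurable_fun_upd[where J = "UNIV - {i}"]) auto
    then show ?thesis by (simp add: case_prod_beta')
  qed
  have decomp: "PiM UNIV M = distr (M i \<Otimes>\<^sub>M N) (PiM UNIV M) (\<lambda>(\<theta>, w). w(i := \<theta>))"
    using distr_pair_PiM_eq_PiM[of "UNIV - {i}" M i] prob by (simp add: N_def insert_UNIV)
  have *: "(\<integral>\<^sup>+w. G w \<partial>PiM UNIV M) = (\<integral>\<^sup>+\<theta>. \<integral>\<^sup>+w. G (w(i := \<theta>)) \<partial>N \<partial>M i)"
    if [measurable]: "G \<in> borel_measurable (PiM UNIV M)" for G :: "('i \<Rightarrow> 'b) \<Rightarrow> ennreal"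
    by (subst decomp, subst nn_integral_distr, simp, simp, subst N.nn_integral_fst[symmetric])
      (simp_all add: case_prod_beta')
  have "(\<integral>\<^sup>+w. F (w i) w \<partial>PiM UNIV M) = (\<integral>\<^sup>+\<theta>. \<integral>\<^sup>+w. F \<theta> (w(i := \<theta>)) \<partial>N \<partial>M i)"
    by (subst *) (simp_all add: measurable_compose[OF _ F, unfolded case_prod_beta'])
  \<comment> \<open>The splitting is applied backwards for fixed \<open>\<theta>\<close>: the value
    \<open>\<theta>'\<close> placed in coordinate \<open>i\<close> is invisible to
    \<open>F \<theta>\<close>, so integrating over it contributes the factor 1.\<close>
  also have "\<dots> = (\<integral>\<^sup>+\<theta>. \<integral>\<^sup>+w. F \<theta> w \<partial>PiM UNIV M \<partial>M i)"
  proof (rule nn_integral_cong)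
    fix \<theta> assume \<theta>: "\<theta> \<in> space (M i)"
    have "(\<integral>\<^sup>+w. F \<theta> w \<partial>PiM UNIV M) = (\<integral>\<^sup>+\<theta>'. \<integral>\<^sup>+w. F \<theta> (w(i := \<theta>')) \<partial>N \<partial>M i)"
      using measurable_compose[OF measurable_Pair1'[OF \<theta>] F] by (subst *) simp_all
    also have "\<dots> = (\<integral>\<^sup>+\<theta>'. \<integral>\<^sup>+w. F \<theta> (w(i := \<theta>)) \<partial>N \<partial>M i)"
      by (simp add: indep)
    also have "\<dots> = (\<integral>\<^sup>+w. F \<theta> (w(i := \<theta>)) \<partial>N)"
      by (simp add: Mi.emeasure_space_1)
    finally show "(\<integral>\<^sup>+w. F \<theta> (w(i := \<theta>)) \<partial>N) = (\<integral>\<^sup>+w. F \<theta> w \<partial>PiM UNIV M)" ..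
  qed
  finally show ?thesis .
qed

text \<open>Serves to carry the fractional moment of \<open>L 1\<close> over to every
  \<open>L n\<close>. Equality of laws enters as equality of the measures of preimages, the form in
  which (A2) states it.\<close>

lemma nn_integral_eq_if_same_law:
  fixes X :: "'b \<Rightarrow> 'd" and Y :: "'e \<Rightarrow> 'd"
  assumes "prob_space M" "prob_space N"
    and [measurable]: "X \<in> M \<rightarrow>\<^sub>M R" "Y \<in> N \<rightarrow>\<^sub>M R" "h \<in> borel_measurable R"
    and law: "\<And>E. E \<in> sets R \<Longrightarrow>
      measure M (X -` E \<inter> space M) = measure N (Y -` E \<inter> space N)"
  shows "(\<integral>\<^sup>+w. h (X w) \<partial>M) = (\<integral>\<^sup>+w. h (Y w) \<partial>N)"
proof -
  interpret M: prob_space M by fact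
  interpret N: prob_space N by fact
  have "distr M R X = distr N R Y"
    by (rule measure_eqI) (simp_all add: emeasure_distr M.emeasure_eq_measure N.emeasure_eq_measure law)
  then have "(\<integral>\<^sup>+r. h r \<partial>distr M R X) = (\<integral>\<^sup>+r. h r \<partial>distr N R Y)" by simp
  then show ?thesis by (simp add: nn_integral_distr)
qed

lemma (in prob_space) distr_pair_snd:
  assumes "sigma_finite_measure N"
  shows "distr (M \<Otimes>\<^sub>M N) N snd = N"
proof -
  interpret N: sigma_finite_measure N by fact
  show ?thesis
  proof (rule measure_eqI)
    fix A assume A: "A \<in> sets (distr (M \<Otimes>\<^sub>M N) N snd)"
    then have "snd -` A \<inter> space (M \<Otimes>\<^sub>M N) = space M \<times> A"
      using sets.sets_into_space[of A N] by (auto simp: space_pair_measure)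
    then show "emeasure (distr (M \<Otimes>\<^sub>M N) N snd) A = emeasure N A"
      using A by (simp add: emeasure_distr N.emeasure_pair_measure_Times emeasure_space_1)
  qed simp
qed

section \<open>Summability of distances\<close>

lemma Cauchy_if_summable_dist:
  fixes u :: "nat \<Rightarrow> 'a::metric_space"
  assumes "summable (\<lambda>n. dist (u (Suc n)) (u n))"
  shows "Cauchy u"
proof (rule metric_CauchyI)
  fix e :: real assume "e > 0"
  then obtain N where N: "\<And>m n. m \<ge> N \<Longrightarrow> norm (\<Sum>k = m..<n. dist (u (Suc k)) (u k)) < e"
    using assms unfolding summable_Cauchy by blast
  have tele: "dist (u n) (u m) \<le> (\<Sum>k = m..<n. dist (u (Suc k)) (u k))" if "m \<le> n" for m n
    using that
  proof (induction n rule: dec_induct)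
    case (step n)
    then show ?case using dist_triangle[of "u (Suc n)" "u m" "u n"] by simp
  qed simp
  have main: "dist (u n) (u m) < e" if "N \<le> m" "m \<le> n" for m n
    using tele[OF that(2)] N[OF that(1), of n] by (simp add: sum_nonneg)
  show "\<exists>M. \<forall>m\<ge>M. \<forall>n\<ge>M. dist (u m) (u n) < e"
  proof (intro exI[of _ N] allI impI)
    fix m n assume "m \<ge> N" "n \<ge> N"
    then show "dist (u m) (u n) < e"
      using main[of m n] main[of n m] by (cases "m \<le> n") (simp_all add: dist_commute)
  qed
qed

text \<open>By Tonelli the sum of the \<open>a\<close>-th powers from \<open>N\<close> on has finite
  mean, hence is finite almost surely. Its terms are then eventually below 1, where
  \<open>a \<le> 1\<close> makes a distance at most its \<open>a\<close>-th power, so the distances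
  themselves are summable.\<close>

lemma AE_summable_dist:
  fixes u v :: "nat \<Rightarrow> 'b \<Rightarrow> 'a::{metric_space, second_countable_topology}"
  assumes [measurable]: "\<And>n. u n \<in> borel_measurable M" "\<And>n. v n \<in> borel_measurable M"
    and a: "0 < a" "a \<le> 1" and q: "0 \<le> q" "q < 1" and "0 \<le> C"
    and bound: "\<And>n. n \<ge> N \<Longrightarrow>
      (\<integral>\<^sup>+w. ennreal (dist (u n w) (v n w) powr a) \<partial>M) \<le> ennreal (C * q ^ n)"
  shows "AE w in M. summable (\<lambda>n. dist (u n w) (v n w))"
proof -
  let ?d = "\<lambda>n w. dist (u (n + N) w) (v (n + N) w)"
  have sm: "summable (\<lambda>n. C * q ^ (n + N))"
    using q by (intro summable_mult summable_ignore_initial_segment summable_geometric) simp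
  have "(\<integral>\<^sup>+w. (\<Sum>n. ennreal (?d n w powr a)) \<partial>M)
      = (\<Sum>n. \<integral>\<^sup>+w. ennreal (?d n w powr a) \<partial>M)"
    by (rule nn_integral_suminf) simp
  also have "\<dots> \<le> (\<Sum>n. ennreal (C * q ^ (n + N)))"
    by (intro suminf_le bound) auto
  also have "\<dots> = ennreal (\<Sum>n. C * q ^ (n + N))"
    using sm q \<open>0 \<le> C\<close> by (intro suminf_ennreal2) auto
  finally have "(\<integral>\<^sup>+w. (\<Sum>n. ennreal (?d n w powr a)) \<partial>M) \<noteq> \<infinity>"
    by (auto simp: top_unique)
  then have "AE w in M. (\<Sum>n. ennreal (?d n w powr a)) \<noteq> \<infinity>"
    by (intro nn_integral_PInf_AE) simp_all
  then show ?thesis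
  proof (rule AE_mp, intro AE_I2 impI)
    fix w assume "(\<Sum>n. ennreal (?d n w powr a)) \<noteq> \<infinity>"
    then have sma: "summable (\<lambda>n. ?d n w powr a)"
      by (intro summable_suminf_not_top) auto
    then have "\<forall>\<^sub>F n in sequentially. ?d n w powr a < 1"
      by (intro order_tendstoD(2)[OF summable_LIMSEQ_zero]) auto
    then have "\<forall>\<^sub>F n in sequentially. norm (?d n w) \<le> ?d n w powr a"
    proof (rule eventually_mono)
      fix n assume *: "?d n w powr a < 1"
      then have "?d n w < 1"
        using a by (smt (verit) ge_one_powr_ge_zero)
      then show "norm (?d n w) \<le> ?d n w powr a"
        using powr_mono'[of a 1 "?d n w"] a by simp
    qed
    then have "summable (\<lambda>n. ?d n w)"
      by (rule summable_comparison_test_ev[OF _ sma])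
    then show "summable (\<lambda>n. dist (u n w) (v n w))"
      by (rule summable_iff_shift[THEN iffD1])
  qed
qed

section \<open>Test functions of the bounded Lipschitz metric\<close>

lemma L_b1_measurable: "f \<in> L_b1 \<Longrightarrow> f \<in> borel_measurable borel"
  unfolding L_b1_def
  by (auto intro!: borel_measurable_continuous_onI lipschitz_on_continuous_on)

lemma L_b1_abs_le: "f \<in> L_b1 \<Longrightarrow> \<bar>f x\<bar> \<le> 1"
  unfolding L_b1_def by (auto simp: abs_le_iff dest!: subsetD[of _ _ "f x"])

text \<open>Up to distance 1 the Lipschitz bound suffices, since \<open>t \<le> t powr a\<close>
  there. Beyond distance 1 the values in \<open>[-1, 1]\<close> differ by at most 2, while the power
  is at least 1.\<close>

lemma L_b1_diff_le_powr:
  assumes f: "f \<in> L_b1" and a: "0 < a" "a \<le> 1"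
  shows "\<bar>f x - f y\<bar> \<le> 2 * dist x y powr a"
proof (cases "dist x y \<le> 1")
  case True
  have "\<bar>f x - f y\<bar> \<le> dist x y"
    using f lipschitz_onD[of 1 UNIV f x y] by (simp add: L_b1_def dist_real_def)
  also have "\<dots> \<le> 2 * dist x y powr a"
    using powr_mono'[of a 1 "dist x y"] True a by (smt (verit) powr_ge_zero powr_one zero_le_dist)
  finally show ?thesis .
next
  case False
  then have "1 \<le> dist x y powr a" using a by (intro ge_one_powr_ge_zero) auto
  then show ?thesis using L_b1_abs_le[OF f, of x] L_b1_abs_le[OF f, of y] by linarith
qed

text \<open>Coupling bound: \<open>u\<close> and \<open>v\<close> live on one probability space, so
  the mean snowflaked distance between them controls the difference of their laws against
  \<open>f\<close>.\<close>

lemma (in prob_space) L_b1_integral_diff_le: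
  fixes u v :: "'a \<Rightarrow> 'c::{metric_space, second_countable_topology}"
  assumes f: "f \<in> L_b1" and a: "0 < a" "a \<le> 1" and "0 \<le> B"
    and [measurable]: "u \<in> borel_measurable M" "v \<in> borel_measurable M"
    and bound: "(\<integral>\<^sup>+w. ennreal (dist (u w) (v w) powr a) \<partial>M) \<le> ennreal B"
  shows "\<bar>(\<integral>w. f (u w) \<partial>M) - (\<integral>w. f (v w) \<partial>M)\<bar> \<le> 2 * B"
proof -
  note [measurable] = L_b1_measurable[OF f]
  have int: "integrable M (\<lambda>w. f (z w))" if [measurable]: "z \<in> borel_measurable M" for z
    using L_b1_abs_le[OF f] by (intro integrable_const_bound[where B = 1]) auto
  have intd: "integrable M (\<lambda>w. dist (u w) (v w) powr a)"
    using bound by (intro integrableI_nonneg) (auto intro: order.strict_trans1)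
  have "\<bar>(\<integral>w. f (u w) \<partial>M) - (\<integral>w. f (v w) \<partial>M)\<bar> = \<bar>\<integral>w. f (u w) - f (v w) \<partial>M\<bar>"
    by (simp add: int)
  also have "\<dots> \<le> (\<integral>w. \<bar>f (u w) - f (v w)\<bar> \<partial>M)"
    by (rule integral_abs_bound)
  also have "\<dots> \<le> (\<integral>w. 2 * dist (u w) (v w) powr a \<partial>M)"
    using L_b1_diff_le_powr[OF f a] by (intro integral_mono) (auto simp: int intd)
  also have "\<dots> \<le> 2 * B"
    using bound \<open>0 \<le> B\<close> by (simp add: nn_integral_eq_integral[OF intd])
  finally show ?thesis .
qed

lemma d_BL_le:
  assumes "\<And>f. f \<in> L_b1 \<Longrightarrow> \<bar>(\<integral>x. f x \<partial>\<mu>) - (\<integral>x. f x \<partial>\<nu>)\<bar> \<le> B"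
  shows "d_BL \<mu> \<nu> \<le> B"
  unfolding d_BL_def
proof (rule cSUP_least)
  have "(\<lambda>_. 0) \<in> L_b1" by (auto simp: L_b1_def intro!: lipschitz_onI)
  then show "L_b1 \<noteq> {}" by blast
qed (fact assms)


text \<open>The triangle inequality moves the base point from \<open>z\<close> to \<open>x0\<close>.
  Integrability ensures that the Bochner integral of \<open>dist x x0\<close> in the final bound is
  the true first moment and not the default value 0.\<close>

lemma M11_integrable_dist:
  assumes "\<mu> \<in> M11"
  shows "integrable \<mu> (\<lambda>x. dist x (x0::'a::{metric_space, second_countable_topology}))"
proof -
  obtain z where z: "(\<integral>\<^sup>+x. ennreal (dist x z) \<partial>\<mu>) < \<infinity>"
    and \<mu>[measurable_cong]: "sets \<mu> = sets borel" and "prob_space \<mu>"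
    using assms by (auto simp: M11_def M1_def)
  interpret prob_space \<mu> by fact
  have "integrable \<mu> (\<lambda>x. dist x z)"
    using z by (intro integrableI_nonneg) auto
  then have "integrable \<mu> (\<lambda>x. dist x z + dist z x0)" by simp
  then show ?thesis
    by (rule Bochner_Integration.integrable_bound) (simp_all add: dist_triangle)
qed

section \<open>Backward iterates\<close>

text \<open>The newest map is applied innermost, so a further step only changes the starting point
  fed to the same outer maps. This is why these iterates can converge pointwise. Coordinate
  \<open>n\<close> drives the map with index \<open>Suc n\<close>.\<close>

primrec backward :: "(nat \<Rightarrow> 'b \<Rightarrow> 'a \<Rightarrow> 'a) \<Rightarrow> nat \<Rightarrow> (nat \<Rightarrow> 'b) \<Rightarrow> 'a \<Rightarrow> 'a" where
  "backward S 0 w x = x"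
| "backward S (Suc n) w x = backward S n w (S (Suc n) (w n) x)"

text \<open>The first \<open>n\<close> steps read only the coordinates below \<open>n\<close>. This
  supplies the independence hypothesis for splitting off coordinate \<open>n\<close>.\<close>

lemma backward_fun_upd: "n \<le> k \<Longrightarrow> backward S n (w(k := \<theta>)) x = backward S n w x"
  by (induction n arbitrary: x) auto

locale random_maps =
  fixes T :: "nat \<Rightarrow> 'b measure" and S :: "nat \<Rightarrow> 'b \<Rightarrow> 'a::polish_space \<Rightarrow> 'a"
  assumes prob: "\<And>n. n \<ge> 1 \<Longrightarrow> prob_space (T n)"
    and S_meas: "\<And>n. n \<ge> 1 \<Longrightarrow> (\<lambda>(x, \<theta>). S n \<theta> x) \<in> borel \<Otimes>\<^sub>M T n \<rightarrow>\<^sub>M borel"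
begin

abbreviation \<Phi> :: "nat \<Rightarrow> (nat \<Rightarrow> 'b) \<Rightarrow> 'a \<Rightarrow> 'a" where
  "\<Phi> \<equiv> backward S"

text \<open>The shift by one makes the coordinates start at 0 while the measures start at
  \<open>T 1\<close>; nothing is assumed about \<open>T 0\<close>.\<close>

definition \<Omega> :: "(nat \<Rightarrow> 'b) measure" where
  "\<Omega> = PiM UNIV (\<lambda>i. T (Suc i))"

sublocale \<Omega>: prob_space \<Omega>
  unfolding \<Omega>_def by (intro prob_space_PiM prob) simp

lemma measurable_S [measurable (raw)]:
  assumes [measurable]: "f \<in> N \<rightarrow>\<^sub>M T (Suc n)" "g \<in> N \<rightarrow>\<^sub>M borel"
  shows "(\<lambda>z. S (Suc n) (f z) (g z)) \<in> N \<rightarrow>\<^sub>M borel"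
  using measurable_compose[OF measurable_Pair[OF assms(2,1)] S_meas[of "Suc n"]] by simp

lemma measurable_coordinate [measurable]: "(\<lambda>w. w i) \<in> \<Omega> \<rightarrow>\<^sub>M T (Suc i)"
  unfolding \<Omega>_def by (rule measurable_component_singleton) simp

lemma measurable_\<Phi> [measurable (raw)]:
  assumes "f \<in> N \<rightarrow>\<^sub>M \<Omega>" "g \<in> N \<rightarrow>\<^sub>M borel"
  shows "(\<lambda>z. \<Phi> n (f z) (g z)) \<in> N \<rightarrow>\<^sub>M borel"
  using assms(2)
proof (induction n arbitrary: g)
  case (Suc n)
  note [measurable] = assms(1) Suc.prems
  have "(\<lambda>z. S (Suc n) (f z n) (g z)) \<in> N \<rightarrow>\<^sub>M borel"
    by (intro measurable_S measurable_compose[OF assms(1) measurable_coordinate]) simp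
  then show ?case by (simp add: Suc.IH)
qed simp

lemma nn_integral_\<Omega>_Suc:
  assumes [measurable]: "(\<lambda>(\<theta>, w). F \<theta> w) \<in> borel_measurable (T (Suc n) \<Otimes>\<^sub>M \<Omega>)"
    and "\<And>\<theta> \<theta>' w. F \<theta> (w(n := \<theta>')) = F \<theta> w"
  shows "(\<integral>\<^sup>+w. F (w n) w \<partial>\<Omega>) = (\<integral>\<^sup>+\<theta>. \<integral>\<^sup>+w. F \<theta> w \<partial>\<Omega> \<partial>T (Suc n))"
  using nn_integral_PiM_coordinate[of "\<lambda>i. T (Suc i)" F n] assms prob by (simp add: \<Omega>_def)

section \<open>The law of the backward iterates\<close>

lemma sets_apply_step:
  assumes "sets \<mu> = sets borel"
  shows "sets (apply_step (T (Suc n)) (S (Suc n)) \<mu>) = sets borel"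
  unfolding apply_step_def using sets_eq_imp_space_eq[OF assms]
  by (intro sets_bind) (auto simp: step_kernel_def)

lemma sets_P_bar: "sets \<mu> = sets borel \<Longrightarrow> sets (P_bar T S n \<mu>) = sets borel"
  by (induction n arbitrary: \<mu>) (simp_all add: sets_apply_step)

text \<open>Both recursions treat index \<open>Suc n\<close> first: \<open>P_bar\<close> changes the
  initial measure, \<open>backward\<close> the initial point. The induction therefore runs over
  arbitrary \<open>\<mu>\<close>, and independence of coordinate \<open>n\<close> joins the new
  kernel to the earlier ones.\<close>

lemma nn_integral_P_bar:
  assumes "sets \<mu> = sets borel" and [measurable]: "h \<in> borel_measurable borel"
  shows "(\<integral>\<^sup>+x. h x \<partial>P_bar T S n \<mu>) = (\<integral>\<^sup>+x. \<integral>\<^sup>+w. h (\<Phi> n w x) \<partial>\<Omega> \<partial>\<mu>)"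
  using assms(1)
proof (induction n arbitrary: \<mu>)
  case 0
  then show ?case by (simp add: \<Omega>.emeasure_space_1)
next
  case (Suc n)
  have step: "step_kernel (T (Suc n)) (S (Suc n)) \<in> borel \<rightarrow>\<^sub>M subprob_algebra borel"
    by (intro step_kernel_measurable prob S_meas) simp_all
  have step': "step_kernel (T (Suc n)) (S (Suc n)) \<in> \<mu> \<rightarrow>\<^sub>M subprob_algebra borel"
    using step Suc.prems by (simp cong: measurable_cong_sets)
  have "(\<integral>\<^sup>+x. h x \<partial>P_bar T S (Suc n) \<mu>) =
      (\<integral>\<^sup>+x. \<integral>\<^sup>+w. h (\<Phi> n w x) \<partial>\<Omega> \<partial>apply_step (T (Suc n)) (S (Suc n)) \<mu>)"
    using Suc.prems by (simp add: Suc.IH sets_apply_step)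
  also have "\<dots> = (\<integral>\<^sup>+x. \<integral>\<^sup>+y. \<integral>\<^sup>+w. h (\<Phi> n w y) \<partial>\<Omega> \<partial>step_kernel (T (Suc n)) (S (Suc n)) x \<partial>\<mu>)"
    unfolding apply_step_def by (intro nn_integral_bind[OF _ step']) measurable
  also have "\<dots> = (\<integral>\<^sup>+x. \<integral>\<^sup>+\<theta>. \<integral>\<^sup>+w. h (\<Phi> n w (S (Suc n) \<theta> x)) \<partial>\<Omega> \<partial>T (Suc n) \<partial>\<mu>)"
    unfolding step_kernel_def by (subst nn_integral_distr) simp_all
  also have "\<dots> = (\<integral>\<^sup>+x. \<integral>\<^sup>+w. h (\<Phi> (Suc n) w x) \<partial>\<Omega> \<partial>\<mu>)"
    by (subst nn_integral_\<Omega>_Suc[symmetric]) (simp_all add: backward_fun_upd)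
  finally show ?case .
qed

text \<open>Realizes the laws for all \<open>n\<close> and all initial measures through one driving
  sequence \<open>w\<close>, independent of the starting point. All later comparisons use this
  coupling.\<close>

lemma P_bar_eq_distr:
  assumes "\<mu> \<in> M1"
  shows "P_bar T S n \<mu> = distr (\<mu> \<Otimes>\<^sub>M \<Omega>) borel (\<lambda>(x, w). \<Phi> n w x)"
proof (rule measure_eqI)
  have \<mu>[measurable_cong]: "sets \<mu> = sets borel"
    using assms by (simp add: M1_def)
  show "sets (P_bar T S n \<mu>) = sets (distr (\<mu> \<Otimes>\<^sub>M \<Omega>) borel (\<lambda>(x, w). \<Phi> n w x))"
    using sets_P_bar[OF \<mu>] by simp
  fix A assume "A \<in> sets (P_bar T S n \<mu>)"
  then have [measurable]: "A \<in> sets borel" by (simp add: sets_P_bar[OF \<mu>])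
  have "emeasure (P_bar T S n \<mu>) A = (\<integral>\<^sup>+x. indicator A x \<partial>P_bar T S n \<mu>)"
    by (simp add: sets_P_bar[OF \<mu>])
  also have "\<dots> = (\<integral>\<^sup>+x. \<integral>\<^sup>+w. indicator A (\<Phi> n w x) \<partial>\<Omega> \<partial>\<mu>)"
    by (rule nn_integral_P_bar[OF \<mu>]) simp
  also have "\<dots> = (\<integral>\<^sup>+z. indicator A ((\<lambda>(x, w). \<Phi> n w x) z) \<partial>(\<mu> \<Otimes>\<^sub>M \<Omega>))"
    by (subst \<Omega>.nn_integral_fst[symmetric]) simp_all
  also have "\<dots> = (\<integral>\<^sup>+x. indicator A x \<partial>distr (\<mu> \<Otimes>\<^sub>M \<Omega>) borel (\<lambda>(x, w). \<Phi> n w x))"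
    by (subst nn_integral_distr) simp_all
  also have "\<dots> = emeasure (distr (\<mu> \<Otimes>\<^sub>M \<Omega>) borel (\<lambda>(x, w). \<Phi> n w x)) A"
    by simp
  finally show "emeasure (P_bar T S n \<mu>) A = \<dots>" .
qed

lemma P_bar_M1:
  assumes \<mu>: "\<mu> \<in> M1"
  shows "P_bar T S n \<mu> \<in> M1"
proof -
  have [measurable_cong]: "sets \<mu> = sets borel" using \<mu> by (simp add: M1_def)
  interpret \<mu>: prob_space \<mu> using \<mu> by (simp add: M1_def)
  interpret \<mu>\<Omega>: pair_prob_space \<mu> \<Omega> ..
  show ?thesis
    unfolding P_bar_eq_distr[OF \<mu>] M1_def by (simp add: \<mu>\<Omega>.prob_space_distr)
qed

lemma integral_P_bar:
  fixes f :: "'a \<Rightarrow> real"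
  assumes \<mu>: "\<mu> \<in> M1" and [measurable]: "f \<in> borel_measurable borel"
  shows "(\<integral>x. f x \<partial>P_bar T S n \<mu>) = (\<integral>(x, w). f (\<Phi> n w x) \<partial>(\<mu> \<Otimes>\<^sub>M \<Omega>))"
proof -
  have [measurable_cong]: "sets \<mu> = sets borel"
    using assms by (simp add: M1_def)
  show ?thesis
    unfolding P_bar_eq_distr[OF \<mu>] by (subst integral_distr) (simp_all add: case_prod_beta')
qed

lemma integral_snd_\<Omega>:
  fixes f :: "(nat \<Rightarrow> 'b) \<Rightarrow> real"
  assumes "\<mu> \<in> M1" and [measurable]: "f \<in> borel_measurable \<Omega>"
  shows "(\<integral>(x, w). f w \<partial>(\<mu> \<Otimes>\<^sub>M \<Omega>)) = (\<integral>w. f w \<partial>\<Omega>)"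
proof -
  interpret \<mu>: prob_space \<mu> using assms by (simp add: M1_def)
  have "(\<integral>w. f w \<partial>\<Omega>) = (\<integral>w. f w \<partial>distr (\<mu> \<Otimes>\<^sub>M \<Omega>) \<Omega> snd)"
    by (subst \<mu>.distr_pair_snd) (auto intro: \<Omega>.sigma_finite_measure_axioms)
  also have "\<dots> = (\<integral>(x, w). f w \<partial>(\<mu> \<Otimes>\<^sub>M \<Omega>))"
    by (subst integral_distr) (simp_all add: case_prod_beta')
  finally show ?thesis ..
qed

end

section \<open>Contraction in the snowflaked metric\<close>

text \<open>The form that the assumptions take after raising distances to the power
  \<open>a\<close>: contraction in mean with a common factor \<open>q\<close> for all indices, and a
  drift of \<open>x0\<close> that is bounded from \<open>n0\<close> on.\<close>

locale contracting_random_maps = random_maps T S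
  for T :: "nat \<Rightarrow> 'b measure" and S :: "nat \<Rightarrow> 'b \<Rightarrow> 'a::polish_space \<Rightarrow> 'a" +
  fixes a q D :: real and x0 :: 'a and n0 :: nat
  assumes a: "0 < a" "a \<le> 1" and q: "0 < q" "q < 1" and D: "0 \<le> D"
    and contraction: "\<And>n x y. n \<ge> 1 \<Longrightarrow>
      (\<integral>\<^sup>+\<theta>. ennreal (dist (S n \<theta> x) (S n \<theta> y) powr a) \<partial>T n) \<le> ennreal (q * dist x y powr a)"
    and drift: "\<And>n. n \<ge> 1 \<Longrightarrow> n \<ge> n0 \<Longrightarrow>
      (\<integral>\<^sup>+\<theta>. ennreal (dist (S n \<theta> x0) x0 powr a) \<partial>T n) \<le> ennreal D"
begin

text \<open>The innermost map shrinks the mean snowflaked distance of the starting points by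
  \<open>q\<close>. The outer \<open>n\<close> maps are independent of it and contribute
  \<open>q ^ n\<close> by induction, which is why \<open>x\<close> and \<open>y\<close> stay
  arbitrary.\<close>

lemma \<Phi>_contraction:
  "(\<integral>\<^sup>+w. ennreal (dist (\<Phi> n w x) (\<Phi> n w y) powr a) \<partial>\<Omega>) \<le> ennreal (q ^ n * dist x y powr a)"
proof (induction n arbitrary: x y)
  case 0
  then show ?case by (simp add: \<Omega>.emeasure_space_1)
next
  case (Suc n)
  have "(\<integral>\<^sup>+w. ennreal (dist (\<Phi> (Suc n) w x) (\<Phi> (Suc n) w y) powr a) \<partial>\<Omega>)
    = (\<integral>\<^sup>+\<theta>. \<integral>\<^sup>+w. ennreal (dist (\<Phi> n w (S (Suc n) \<theta> x)) (\<Phi> n w (S (Suc n) \<theta> y)) powr a) \<partial>\<Omega> \<partial>T (Suc n))"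
    by (subst nn_integral_\<Omega>_Suc[symmetric]) (simp_all add: backward_fun_upd)
  also have "\<dots> \<le> (\<integral>\<^sup>+\<theta>. ennreal (q ^ n * dist (S (Suc n) \<theta> x) (S (Suc n) \<theta> y) powr a) \<partial>T (Suc n))"
    by (intro nn_integral_mono Suc.IH)
  also have "\<dots> = ennreal (q ^ n) *
      (\<integral>\<^sup>+\<theta>. ennreal (dist (S (Suc n) \<theta> x) (S (Suc n) \<theta> y) powr a) \<partial>T (Suc n))"
    using q by (subst nn_integral_cmult[symmetric]) (simp_all add: ennreal_mult)
  also have "\<dots> \<le> ennreal (q ^ n) * ennreal (q * dist x y powr a)"
    by (intro mult_left_mono contraction) simp_all
  also have "\<dots> = ennreal (q ^ Suc n * dist x y powr a)"
    using q by (simp add: ennreal_mult[symmetric] mult_ac)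
  finally show ?case .
qed

text \<open>The two iterates share their outer \<open>n\<close> maps and differ only in the starting
  points \<open>S (Suc n) \<theta> x0\<close> and \<open>x0\<close>. The outer maps give
  \<open>q ^ n\<close>, the drift gives \<open>D\<close>.\<close>

lemma \<Phi>_increment:
  assumes "n \<ge> n0"
  shows "(\<integral>\<^sup>+w. ennreal (dist (\<Phi> (Suc n) w x0) (\<Phi> n w x0) powr a) \<partial>\<Omega>) \<le> ennreal (D * q ^ n)"
proof -
  have "(\<integral>\<^sup>+w. ennreal (dist (\<Phi> (Suc n) w x0) (\<Phi> n w x0) powr a) \<partial>\<Omega>)
    = (\<integral>\<^sup>+\<theta>. \<integral>\<^sup>+w. ennreal (dist (\<Phi> n w (S (Suc n) \<theta> x0)) (\<Phi> n w x0) powr a) \<partial>\<Omega> \<partial>T (Suc n))"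
    by (subst nn_integral_\<Omega>_Suc[symmetric]) (simp_all add: backward_fun_upd)
  also have "\<dots> \<le> (\<integral>\<^sup>+\<theta>. ennreal (q ^ n * dist (S (Suc n) \<theta> x0) x0 powr a) \<partial>T (Suc n))"
    by (intro nn_integral_mono \<Phi>_contraction)
  also have "\<dots> = ennreal (q ^ n) *
      (\<integral>\<^sup>+\<theta>. ennreal (dist (S (Suc n) \<theta> x0) x0 powr a) \<partial>T (Suc n))"
    using q by (subst nn_integral_cmult[symmetric]) (simp_all add: ennreal_mult)
  also have "\<dots> \<le> ennreal (q ^ n) * ennreal D"
    using assms by (intro mult_left_mono drift) simp_all
  also have "\<dots> = ennreal (D * q ^ n)"
    using q D by (simp add: ennreal_mult[symmetric] mult_ac)
  finally show ?thesis .
qed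

section \<open>The almost sure limit and its law\<close>

definition limit :: "(nat \<Rightarrow> 'b) \<Rightarrow> 'a" where
  "limit w = (if Cauchy (\<lambda>n. \<Phi> n w x0) then lim (\<lambda>n. \<Phi> n w x0) else x0)"

definition \<pi> :: "'a measure" where
  "\<pi> = distr \<Omega> borel limit"

text \<open>Replacing the iterates by \<open>x0\<close> off the measurable Cauchy set gives a
  sequence that, by completeness, converges everywhere, so its pointwise limit is
  measurable.\<close>

lemma measurable_limit [measurable]: "limit \<in> \<Omega> \<rightarrow>\<^sub>M borel"
proof (rule borel_measurable_LIMSEQ_metric)
  show "(\<lambda>w. if Cauchy (\<lambda>n. \<Phi> n w x0) then \<Phi> i w x0 else x0) \<in> \<Omega> \<rightarrow>\<^sub>M borel" for i
    by measurable
  show "(\<lambda>i. if Cauchy (\<lambda>n. \<Phi> n w x0) then \<Phi> i w x0 else x0) \<longlonglongrightarrow> limit w" for w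
    by (auto simp: limit_def Cauchy_convergent_iff convergent_LIMSEQ_iff)
qed

lemma \<pi>_M1: "\<pi> \<in> M1"
  unfolding M1_def \<pi>_def by (simp add: \<Omega>.prob_space_distr)

text \<open>Increments along \<open>x0\<close> are almost surely summable, hence that orbit is
  Cauchy. The distances between the orbits of \<open>x\<close> and \<open>x0\<close> are summable as
  well, so they vanish and the limit does not depend on \<open>x\<close>. The exceptional null set
  may depend on \<open>x\<close>.\<close>

lemma AE_tendsto_limit: "AE w in \<Omega>. (\<lambda>n. \<Phi> n w x) \<longlonglongrightarrow> limit w"
proof -
  have "AE w in \<Omega>. summable (\<lambda>n. dist (\<Phi> (Suc n) w x0) (\<Phi> n w x0))"
    using a q D \<Phi>_increment by (intro AE_summable_dist[where a = a and q = q and C = D and N = n0]) auto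
  moreover have "AE w in \<Omega>. summable (\<lambda>n. dist (\<Phi> n w x) (\<Phi> n w x0))"
    using a q \<Phi>_contraction[of _ x x0]
    by (intro AE_summable_dist[where a = a and q = q and C = "dist x x0 powr a" and N = 0])
      (auto simp: mult.commute)
  ultimately show ?thesis
  proof eventually_elim
    case (elim w)
    have "(\<lambda>n. \<Phi> n w x0) \<longlonglongrightarrow> limit w"
      using Cauchy_if_summable_dist[OF elim(1)]
      by (simp add: limit_def Cauchy_convergent_iff convergent_LIMSEQ_iff)
    then have "(\<lambda>n. dist (\<Phi> n w x0) (limit w)) \<longlonglongrightarrow> 0"
      by (rule tendsto_dist_iff[THEN iffD1])
    from tendsto_add[OF summable_LIMSEQ_zero[OF elim(2)] this]
    have "(\<lambda>n. dist (\<Phi> n w x) (\<Phi> n w x0) + dist (\<Phi> n w x0) (limit w)) \<longlonglongrightarrow> 0"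
      by simp
    then show ?case
      by (rule metric_tendsto_imp_tendsto) (simp add: dist_triangle)
  qed
qed

text \<open>Almost sure convergence from each fixed starting point is enough, so no moment of
  \<open>\<mu>\<close> enters. Dominated convergence is applied first in \<open>w\<close> for fixed
  \<open>x\<close>, then in \<open>x\<close>.\<close>

lemma weak_convergence:
  assumes \<mu>: "\<mu> \<in> M1"
  shows "converges_weakly (\<lambda>n. P_bar T S n \<mu>) \<pi>"
  unfolding converges_weakly_def
proof (intro allI impI, elim conjE)
  fix f :: "'a \<Rightarrow> real" assume cont: "continuous_on UNIV f" and "bounded (range f)"
  then obtain B where B: "\<And>x. \<bar>f x\<bar> \<le> B"
    unfolding bounded_iff by auto
  have [measurable]: "f \<in> borel_measurable borel"
    using cont by (rule borel_measurable_continuous_onI)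
  have \<mu>_sets[measurable_cong]: "sets \<mu> = sets borel" using \<mu> by (simp add: M1_def)
  interpret \<mu>: prob_space \<mu> using \<mu> by (simp add: M1_def)
  interpret \<mu>\<Omega>: pair_prob_space \<mu> \<Omega> ..
  have fubini: "(\<integral>x. f x \<partial>P_bar T S n \<mu>) = (\<integral>x. \<integral>w. f (\<Phi> n w x) \<partial>\<Omega> \<partial>\<mu>)" for n
  proof -
    have "integrable (\<mu> \<Otimes>\<^sub>M \<Omega>) (\<lambda>(x, w). f (\<Phi> n w x))"
      using B by (intro \<mu>\<Omega>.integrable_const_bound[where B = B]) (auto simp: case_prod_beta')
    from \<mu>\<Omega>.integral_fst'[OF this] show ?thesis
      using \<mu> by (simp add: integral_P_bar)
  qed
  have lim: "(\<lambda>n. \<integral>w. f (\<Phi> n w x) \<partial>\<Omega>) \<longlonglongrightarrow> (\<integral>w. f (limit w) \<partial>\<Omega>)" for x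
  proof (rule integral_dominated_convergence[where w = "\<lambda>_. B"])
    show "AE w in \<Omega>. (\<lambda>n. f (\<Phi> n w x)) \<longlonglongrightarrow> f (limit w)"
      using AE_tendsto_limit[of x] by eventually_elim (auto intro: continuous_on_tendsto_compose[OF cont])
  qed (use B in simp_all)
  \<comment> \<open>The limiting inner integral is constant in \<open>x\<close>, so its mean under
    \<open>\<mu>\<close> is the integral of \<open>f\<close> against \<open>\<pi>\<close>.\<close>
  have "(\<lambda>n. \<integral>x. \<integral>w. f (\<Phi> n w x) \<partial>\<Omega> \<partial>\<mu>) \<longlonglongrightarrow> (\<integral>x. \<integral>w. f (limit w) \<partial>\<Omega> \<partial>\<mu>)"
  proof (rule integral_dominated_convergence[where w = "\<lambda>_. B"])
    show "AE x in \<mu>. norm (\<integral>w. f (\<Phi> n w x) \<partial>\<Omega>) \<le> B" for n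
    proof (rule AE_I2)
      fix x
      have "\<bar>\<integral>w. f (\<Phi> n w x) \<partial>\<Omega>\<bar> \<le> (\<integral>w. \<bar>f (\<Phi> n w x)\<bar> \<partial>\<Omega>)" by (rule integral_abs_bound)
      also have "\<dots> \<le> B"
        using B by (intro \<Omega>.integral_le_const \<Omega>.integrable_const_bound[where B = B]) auto
      finally show "norm (\<integral>w. f (\<Phi> n w x) \<partial>\<Omega>) \<le> B" by simp
    qed
  qed (use lim in simp_all)
  then show "(\<lambda>n. \<integral>x. f x \<partial>P_bar T S n \<mu>) \<longlonglongrightarrow> (\<integral>x. f x \<partial>\<pi>)"
    by (simp add: fubini \<pi>_def integral_distr \<mu>.prob_space)
qed

section \<open>Geometric rate\<close>

text \<open>The distance to the limit is at most the tail of the geometric series of increments,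
  each bounded by \<open>2 * (D * q ^ k)\<close>.\<close>

lemma L_b1_\<Phi>_x0_rate:
  assumes f: "f \<in> L_b1" and "n \<ge> n0"
  shows "\<bar>(\<integral>w. f (\<Phi> n w x0) \<partial>\<Omega>) - (\<integral>x. f x \<partial>\<pi>)\<bar> \<le> 2 * D / (1 - q) * q ^ n"
proof -
  note [measurable] = L_b1_measurable[OF f]
  define e where "e k = (\<integral>w. f (\<Phi> k w x0) \<partial>\<Omega>)" for k
  have cont: "continuous_on UNIV f"
    using f by (auto simp: L_b1_def intro: lipschitz_on_continuous_on)
  have "e \<longlonglongrightarrow> (\<integral>w. f (limit w) \<partial>\<Omega>)"
    unfolding e_def
  proof (rule integral_dominated_convergence[where w = "\<lambda>_. 1"])
    show "AE w in \<Omega>. (\<lambda>k. f (\<Phi> k w x0)) \<longlonglongrightarrow> f (limit w)"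
      using AE_tendsto_limit[of x0] by eventually_elim (auto intro: continuous_on_tendsto_compose[OF cont])
  qed (simp_all add: L_b1_abs_le[OF f])
  then have lim: "e \<longlonglongrightarrow> (\<integral>x. f x \<partial>\<pi>)" by (simp add: \<pi>_def integral_distr)
  have inc: "\<bar>e (Suc k) - e k\<bar> \<le> 2 * (D * q ^ k)" if "k \<ge> n0" for k
    unfolding e_def using a D q by (intro \<Omega>.L_b1_integral_diff_le[OF f a] \<Phi>_increment that) simp_all
  \<comment> \<open>The exact partial geometric sum is kept so that the induction closes. Dropping
    \<open>q ^ m\<close> afterwards gives a bound uniform in \<open>m\<close>, in which
    \<open>m\<close> can tend to infinity.\<close>
  have tele: "\<bar>e m - e n\<bar> \<le> 2 * D * (q ^ n - q ^ m) / (1 - q)" if "n \<le> m" for m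
    using that
  proof (induction m rule: dec_induct)
    case (step m)
    have "\<bar>e (Suc m) - e n\<bar> \<le> 2 * D * (q ^ n - q ^ m) / (1 - q) + 2 * (D * q ^ m)"
      using inc[of m] step \<open>n \<ge> n0\<close> by linarith
    also have "\<dots> = 2 * D * (q ^ n - q ^ Suc m) / (1 - q)"
      using q by (simp add: field_simps)
    finally show ?case .
  qed simp
  have bound: "\<bar>e n - e m\<bar> \<le> 2 * D / (1 - q) * q ^ n" if "n \<le> m" for m
  proof -
    have "2 * D * (q ^ n - q ^ m) / (1 - q) \<le> 2 * D * q ^ n / (1 - q)"
      using q D by (intro divide_right_mono mult_left_mono) auto
    then show ?thesis using tele[OF that] by simp
  qed
  have "(\<lambda>m. \<bar>e n - e m\<bar>) \<longlonglongrightarrow> \<bar>e n - (\<integral>x. f x \<partial>\<pi>)\<bar>"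
    by (intro tendsto_intros lim)
  then have "\<bar>e n - (\<integral>x. f x \<partial>\<pi>)\<bar> \<le> 2 * D / (1 - q) * q ^ n"
    using bound by (intro LIMSEQ_le_const2) auto
  then show ?thesis by (simp add: e_def)
qed

text \<open>Two orbits driven by the same \<open>w\<close>, one started from \<open>\<mu>\<close>
  and one from \<open>x0\<close>, approach each other at rate \<open>q ^ n\<close>. The estimate
  \<open>t powr a \<le> 1 + t\<close> turns the fractional moment of \<open>\<mu>\<close> into its
  first moment.\<close>

lemma L_b1_P_bar_x0_rate:
  assumes f: "f \<in> L_b1" and \<mu>: "\<mu> \<in> M1" and int: "integrable \<mu> (\<lambda>x. dist x x0)"
  shows "\<bar>(\<integral>x. f x \<partial>P_bar T S n \<mu>) - (\<integral>w. f (\<Phi> n w x0) \<partial>\<Omega>)\<bar>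
    \<le> 2 * (q ^ n * (1 + (\<integral>x. dist x x0 \<partial>\<mu>)))"
proof -
  note [measurable] = L_b1_measurable[OF f]
  have \<mu>_sets[measurable_cong]: "sets \<mu> = sets borel" using \<mu> by (simp add: M1_def)
  interpret \<mu>: prob_space \<mu> using \<mu> by (simp add: M1_def)
  interpret \<mu>\<Omega>: pair_prob_space \<mu> \<Omega> ..
  have "(\<integral>\<^sup>+z. ennreal (dist (\<Phi> n (snd z) (fst z)) (\<Phi> n (snd z) x0) powr a) \<partial>(\<mu> \<Otimes>\<^sub>M \<Omega>))
    = (\<integral>\<^sup>+x. \<integral>\<^sup>+w. ennreal (dist (\<Phi> n w x) (\<Phi> n w x0) powr a) \<partial>\<Omega> \<partial>\<mu>)"
    by (subst \<Omega>.nn_integral_fst[symmetric]) simp_all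
  also have "\<dots> \<le> (\<integral>\<^sup>+x. ennreal (q ^ n * (1 + dist x x0)) \<partial>\<mu>)"
  proof (rule nn_integral_mono, rule order.trans[OF \<Phi>_contraction])
    show "ennreal (q ^ n * dist x x0 powr a) \<le> ennreal (q ^ n * (1 + dist x x0))" for x
      using q a by (intro ennreal_leI mult_left_mono powr_le_one_plus) simp_all
  qed
  also have "\<dots> = ennreal (q ^ n * (1 + (\<integral>x. dist x x0 \<partial>\<mu>)))"
    using q int by (subst nn_integral_eq_integral) (simp_all add: \<mu>.prob_space)
  finally have "\<bar>(\<integral>z. f (\<Phi> n (snd z) (fst z)) \<partial>(\<mu> \<Otimes>\<^sub>M \<Omega>)) - (\<integral>z. f (\<Phi> n (snd z) x0) \<partial>(\<mu> \<Otimes>\<^sub>M \<Omega>))\<bar>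
      \<le> 2 * (q ^ n * (1 + (\<integral>x. dist x x0 \<partial>\<mu>)))"
    using q by (intro \<mu>\<Omega>.L_b1_integral_diff_le[OF f a]) simp_all
  moreover have "(\<integral>z. f (\<Phi> n (snd z) x0) \<partial>(\<mu> \<Otimes>\<^sub>M \<Omega>)) = (\<integral>w. f (\<Phi> n w x0) \<partial>\<Omega>)"
    using integral_snd_\<Omega>[OF \<mu>, of "\<lambda>w. f (\<Phi> n w x0)"] by (simp add: case_prod_beta')
  ultimately show ?thesis
    using \<mu> by (simp add: integral_P_bar case_prod_beta')
qed

text \<open>
  The summand \<open>2 / q ^ n0\<close> covers \<open>n < n0\<close>, where nothing is known about the drift and only the
  trivial bound 2 is available.
\<close>

lemma d_BL_rate:
  assumes \<mu>: "\<mu> \<in> M1" and int: "integrable \<mu> (\<lambda>x. dist x x0)"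
  shows "d_BL (P_bar T S n \<mu>) \<pi>
    \<le> (2 + 2 * D / (1 - q) + 2 / q ^ n0) * q ^ n * (1 + (\<integral>x. dist x x0 \<partial>\<mu>))"
proof (rule d_BL_le)
  fix f :: "'a \<Rightarrow> real" assume f: "f \<in> L_b1"
  let ?V = "1 + (\<integral>x. dist x x0 \<partial>\<mu>)"
  let ?\<delta> = "\<bar>(\<integral>x. f x \<partial>P_bar T S n \<mu>) - (\<integral>x. f x \<partial>\<pi>)\<bar>"
  have V: "?V \<ge> 1" by simp
  have nonneg: "0 \<le> 2 * D / (1 - q)" "0 \<le> 2 / q ^ n0" using D q by simp_all
  show "?\<delta> \<le> (2 + 2 * D / (1 - q) + 2 / q ^ n0) * q ^ n * ?V"
  proof (cases "n \<ge> n0")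
    case True
    have "?\<delta> \<le> 2 * (q ^ n * ?V) + 2 * D / (1 - q) * q ^ n"
      using L_b1_P_bar_x0_rate[OF f \<mu> int, of n] L_b1_\<Phi>_x0_rate[OF f True] by linarith
    moreover have "2 * D / (1 - q) * q ^ n * 1 \<le> 2 * D / (1 - q) * q ^ n * ?V"
      using V nonneg q by (intro mult_left_mono mult_nonneg_nonneg) auto
    moreover have "0 \<le> 2 / q ^ n0 * q ^ n * ?V"
      using V q by (intro mult_nonneg_nonneg) auto
    ultimately show ?thesis by (simp add: distrib_right mult.assoc)
  next
    case False
    have abs_le: "\<bar>\<integral>x. f x \<partial>\<nu>\<bar> \<le> 1" if "\<nu> \<in> M1" for \<nu>
    proof -
      interpret \<nu>: prob_space \<nu> using that by (simp add: M1_def)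
      have [measurable]: "f \<in> borel_measurable \<nu>"
        using L_b1_measurable[OF f] that by (simp add: M1_def cong: measurable_cong_sets)
      have "\<bar>\<integral>x. f x \<partial>\<nu>\<bar> \<le> (\<integral>x. \<bar>f x\<bar> \<partial>\<nu>)" by (rule integral_abs_bound)
      also have "\<dots> \<le> 1"
        using L_b1_abs_le[OF f]
        by (intro \<nu>.integral_le_const \<nu>.integrable_const_bound[where B = 1]) auto
      finally show ?thesis .
    qed
    have "P_bar T S n \<mu> \<in> M1" using \<mu> by (rule P_bar_M1)
    then have "?\<delta> \<le> 2" using abs_le[of "P_bar T S n \<mu>"] abs_le[OF \<pi>_M1] by linarith
    \<comment> \<open>From \<open>n < n0\<close> and \<open>q < 1\<close> follows
      \<open>q ^ n \<ge> q ^ n0\<close>, so this summand alone dominates the trivial bound.\<close>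
    moreover have "2 * 1 \<le> 2 / q ^ n0 * q ^ n"
      using False q power_decreasing[of n n0 q] by (simp add: field_simps)
    moreover have "2 / q ^ n0 * q ^ n \<le> (2 + 2 * D / (1 - q) + 2 / q ^ n0) * q ^ n"
      using nonneg q by (intro mult_right_mono) auto
    moreover have "(2 + 2 * D / (1 - q) + 2 / q ^ n0) * q ^ n * 1
        \<le> (2 + 2 * D / (1 - q) + 2 / q ^ n0) * q ^ n * ?V"
      using V nonneg q by (intro mult_left_mono mult_nonneg_nonneg) auto
    ultimately show ?thesis by linarith
  qed
qed

end

section \<open>From (A1), (A2) and (A3') to contraction in mean\<close>

theorem theorem3p1:
  fixes T :: "nat \<Rightarrow> 'b measure"
    and S :: "nat \<Rightarrow> 'b \<Rightarrow> 'a::polish_space \<Rightarrow> 'a"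
    and L :: "nat \<Rightarrow> 'b \<Rightarrow> real"
    and x0 :: 'a
    and n0 :: nat
  assumes prob: "\<And>n. n \<ge> 1 \<Longrightarrow> prob_space (T n)"
    and S_meas: "\<And>n. n \<ge> 1 \<Longrightarrow> (\<lambda>(x, \<theta>). S n \<theta> x) \<in> borel \<Otimes>\<^sub>M T n \<rightarrow>\<^sub>M borel"
    and L_meas: "\<And>n. n \<ge> 1 \<Longrightarrow> L n \<in> T n \<rightarrow>\<^sub>M restrict_space borel {0<..}"
    and n0: "n0 \<ge> 1"
    and A1: "\<And>n. n \<ge> 1 \<Longrightarrow>
          AE \<theta> in T n. \<forall>x y. dist (S n \<theta> x) (S n \<theta> y) \<le> L n \<theta> * dist x y"
    and A2_law: "\<And>E m n. E \<in> sets (restrict_space borel {0<..}) \<Longrightarrow> m \<ge> 1 \<Longrightarrow> n \<ge> 1 \<Longrightarrow>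
          measure (T m) (L m -` E \<inter> space (T m)) = measure (T n) (L n -` E \<inter> space (T n))"
    and A2_R: "(\<integral>\<^sup>+\<theta>. ennreal (L 1 \<theta>) \<partial>T 1) < \<infinity>"
    and A2_ln: "ext_integral (T 1) (\<lambda>\<theta>. ln (L 1 \<theta>)) < 0"
    and A3': "(SUP n\<in>{n0..}. \<integral>\<^sup>+\<theta>. ennreal (dist x0 (S n \<theta> x0)) \<partial>T n) < \<infinity>"
  shows "\<exists>\<pi>\<in>M1.
           (\<exists>q C. 0 < q \<and> q < 1 \<and> 0 \<le> C \<and>
              (\<forall>\<mu>\<in>M11. \<forall>n\<ge>1.
                 d_BL (P_bar T S n \<mu>) \<pi> \<le> C * q ^ n * (1 + (\<integral>x. dist x x0 \<partial>\<mu>)))) \<and>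
           (\<forall>\<mu>\<in>M1. converges_weakly (\<lambda>n. P_bar T S n \<mu>) \<pi>)"
proof -
  let ?R = "restrict_space borel {0<..} :: real measure"
  interpret random_maps T S
    using prob S_meas by (rule random_maps.intro)
  have L_borel: "L n \<in> borel_measurable (T n)" and L_pos: "\<And>\<theta>. \<theta> \<in> space (T n) \<Longrightarrow> L n \<theta> > 0"
    if "n \<ge> 1" for n
    using L_meas[OF that] by (auto simp: measurable_restrict_space2_iff)
  obtain a where a: "0 < a" "a \<le> 1" and moment: "(\<integral>\<^sup>+\<theta>. ennreal (L 1 \<theta> powr a) \<partial>T 1) < 1"
    using exists_contracting_moment[OF prob L_borel L_pos A2_R A2_ln] by auto
  have "\<exists>r. r < 1 \<and> m = ennreal r" if "m < 1" for m :: ennreal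
    using that by (cases m) auto
  then obtain r where r: "r < 1" "(\<integral>\<^sup>+\<theta>. ennreal (L 1 \<theta> powr a) \<partial>T 1) = ennreal r"
    using moment by blast
  \<comment> \<open>Only \<open>r < 1\<close> is known; the floor \<open>1 / 2\<close> makes
    \<open>q\<close> positive, so that division by \<open>q ^ n0\<close> is harmless.\<close>
  define q where "q = max (1 / 2) r"
  have q: "0 < q" "q < 1"
    using r(1) by (auto simp: q_def)
  have moment_q: "(\<integral>\<^sup>+\<theta>. ennreal (L n \<theta> powr a) \<partial>T n) \<le> ennreal q" if "n \<ge> 1" for n
  proof -
    have h: "(\<lambda>r. ennreal (r powr a)) \<in> borel_measurable ?R"
      by (rule measurable_restrict_space1) simp
    have "(\<integral>\<^sup>+\<theta>. ennreal (L n \<theta> powr a) \<partial>T n) = (\<integral>\<^sup>+\<theta>. ennreal (L 1 \<theta> powr a) \<partial>T 1)"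
      by (rule nn_integral_eq_if_same_law[OF prob[OF that] prob[OF le_refl] L_meas[OF that]
            L_meas[OF le_refl] h A2_law[OF _ that le_refl]])
    also have "\<dots> \<le> ennreal q"
      unfolding r(2) by (intro ennreal_leI) (simp add: q_def)
    finally show ?thesis .
  qed
  \<comment> \<open>By (A3') the supremum is finite, so \<open>enn2real\<close> loses nothing. The
    drift constant is \<open>1 + \<Delta>\<close> because \<open>t powr a \<le> 1 + t\<close> is
    integrated over a probability space.\<close>
  define \<Delta> where "\<Delta> = enn2real (SUP n\<in>{n0..}. \<integral>\<^sup>+\<theta>. ennreal (dist x0 (S n \<theta> x0)) \<partial>T n)"
  interpret contracting_random_maps T S a q "1 + \<Delta>" x0 n0
  proof unfold_locales
    show "0 \<le> 1 + \<Delta>" by (simp add: \<Delta>_def)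
  next
    fix n :: nat and x y assume n: "n \<ge> 1"
    have "(\<integral>\<^sup>+\<theta>. ennreal (dist (S n \<theta> x) (S n \<theta> y) powr a) \<partial>T n)
        \<le> (\<integral>\<^sup>+\<theta>. ennreal (dist x y powr a) * ennreal (L n \<theta> powr a) \<partial>T n)"
    proof (rule nn_integral_mono_AE)
      show "AE \<theta> in T n. ennreal (dist (S n \<theta> x) (S n \<theta> y) powr a)
          \<le> ennreal (dist x y powr a) * ennreal (L n \<theta> powr a)"
        using A1[OF n] AE_space
      proof eventually_elim
        case (elim \<theta>)
        have "dist (S n \<theta> x) (S n \<theta> y) powr a \<le> (L n \<theta> * dist x y) powr a"
          using elim a by (intro powr_mono2) auto
        then show ?case
          using L_pos[OF n elim(2)]
          by (simp add: powr_mult ennreal_mult[symmetric] mult.commute ennreal_leI)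
      qed
    qed
    also have "\<dots> = ennreal (dist x y powr a) * (\<integral>\<^sup>+\<theta>. ennreal (L n \<theta> powr a) \<partial>T n)"
      using L_borel[OF n] by (intro nn_integral_cmult) measurable
    also have "\<dots> \<le> ennreal (dist x y powr a) * ennreal q"
      using moment_q[OF n] by (intro mult_left_mono) auto
    finally show "(\<integral>\<^sup>+\<theta>. ennreal (dist (S n \<theta> x) (S n \<theta> y) powr a) \<partial>T n)
        \<le> ennreal (q * dist x y powr a)"
      using q by (simp add: ennreal_mult[symmetric] mult.commute)
  next
    fix n assume n: "n \<ge> 1" "n \<ge> n0"
    interpret Tn: prob_space "T n" using n by (intro prob)
    have [measurable]: "(\<lambda>\<theta>. S n \<theta> x0) \<in> borel_measurable (T n)"
      \<comment> \<open>\<open>measurable_S\<close> speaks of index \<open>Suc n\<close>, hence the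
        instance \<open>n - 1\<close>, legitimate as \<open>n \<ge> 1\<close>.\<close>
      using measurable_S[of "\<lambda>\<theta>. \<theta>" "T n" "n - 1" "\<lambda>_. x0"] n by simp
    have "(\<integral>\<^sup>+\<theta>. ennreal (dist (S n \<theta> x0) x0 powr a) \<partial>T n)
        \<le> (\<integral>\<^sup>+\<theta>. 1 + ennreal (dist x0 (S n \<theta> x0)) \<partial>T n)"
      using powr_le_one_plus[OF zero_le_dist a]
      by (intro nn_integral_mono) (simp add: dist_commute ennreal_plus[symmetric] ennreal_leI
          flip: ennreal_1 del: ennreal_plus)
    also have "\<dots> = 1 + (\<integral>\<^sup>+\<theta>. ennreal (dist x0 (S n \<theta> x0)) \<partial>T n)"
      by (subst nn_integral_add) (simp_all add: Tn.emeasure_space_1)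
    also have "\<dots> \<le> 1 + ennreal \<Delta>"
      unfolding \<Delta>_def using A3' n
      by (subst ennreal_enn2real) (auto intro!: add_left_mono SUP_upper simp: less_top)
    finally show "(\<integral>\<^sup>+\<theta>. ennreal (dist (S n \<theta> x0) x0 powr a) \<partial>T n) \<le> ennreal (1 + \<Delta>)"
      by (simp add: \<Delta>_def)
  qed (use a q in simp_all)
  have M11_M1: "\<mu> \<in> M1" if "\<mu> \<in> M11" for \<mu> :: "'a measure"
    using that by (simp add: M11_def)
  let ?C = "2 + 2 * (1 + \<Delta>) / (1 - q) + 2 / q ^ n0"
  have "0 \<le> ?C" using q D by simp
  moreover have "\<forall>\<mu>\<in>M11. \<forall>n\<ge>1.
      d_BL (P_bar T S n \<mu>) \<pi> \<le> ?C * q ^ n * (1 + (\<integral>x. dist x x0 \<partial>\<mu>))"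
    using d_BL_rate[OF M11_M1 M11_integrable_dist] by blast
  ultimately show ?thesis
    using q \<pi>_M1 weak_convergence by blast
qed

end
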